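(* Let $G \cong C_{n_1} \oplus C_{n_2} \oplus \cdots \oplus C_{n_r}$ be a finite abelian group with $n_1 \mid n_2 \mid \cdots \mid n_r$. Consider the statements: (i) Every sequence $S$ over $G$ such that $0$ is not a term of $S$ and $N_0(S) = 2^{|S|-D(G)+1}$ contains exactly $|S|-D(G)+1$ minimal zero-sum subsequences, all of which are pairwise disjoint. (ii) There is a natural number $t = t(G)$ such that $|S| \le t$ for every sequence $S$ over $G$ such that $0$ is not a term of $S$ and $N_0(S) = 2^{|S|-D(G)+1}$. (iii) For every subgroup $H$ of $G$ isomorphic to $C_2$, $D(G) \ge D(G/H) + 2$. (iv) For every sequence $S$ over $G$ with $|S|\ge D(G)-1$, $E(S)$ contains no non-trivial subgroup of $G$. Then (i) implies (ii), and (ii), (iii), (iv) are equivalent.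
   Context: $C_n$ denotes the cyclic group of order $n$. A sequence over $G$ is a finite unordered list $S = g_1 \cdots g_m$ of elements of $G$ with repetition allowed; $|S| = m$; subsequences are sub-multisets. For $g \in G$, $N_g(S) = |\{I \subseteq [1,m] : \sum_{i\in I} g_i = g\}|$ (empty index set included). $D(G)$ is the smallest positive integer $\ell$ such that every sequence over $G$ of length at least $\ell$ has a nonempty subsequence with sum $0$. For $|S|\ge D(G)-1$, $E(S) = \{g\in G : N_g(S) = 2^{|S|-D(G)+1}\}$. A minimal zero-sum sequence is a nonempty sequence with sum $0$ none of whose nonempty proper subsequences has sum $0$. Two subsequences are disjoint if their greatest common divisor (longest sequence dividing both) is empty. *)

theory Defs
  imports Complex_Main "HOL-Library.Multiset" "HOL-Combinatorics.List_Permutation"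
    "HOL-Algebra.Algebra"
begin

text \<open>
  Abelian groups are written multiplicatively, as in HOL-Algebra: the neutral element \<open>\<one>\<close>
  plays the role of 0, and sums are products in the group. Sequences over \<open>G\<close> are finite
  multisets of elements of \<open>carrier G\<close>, and subsequences are sub-multisets.
\<close>

definition seq_over :: "('a, 'b) monoid_scheme \<Rightarrow> 'a multiset \<Rightarrow> bool" where
  "seq_over G S \<longleftrightarrow> set_mset S \<subseteq> carrier G"

definition seq_sum :: "('a, 'b) monoid_scheme \<Rightarrow> 'a multiset \<Rightarrow> 'a" where
  "seq_sum G S = finprod G (\<lambda>x. x [^]\<^bsub>G\<^esub> count S x) (set_mset S)"

text \<open>
  \<open>num_subsums G g S\<close> is \<open>N\<^sub>g(S)\<close>. It counts index sets, so repeated terms are distinguished;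
  the indices refer to an arbitrary enumeration of \<open>S\<close>, on which the number does not depend
  (lemma \<open>num_subsums_mset\<close>).
\<close>

definition num_subsums_list :: "('a, 'b) monoid_scheme \<Rightarrow> 'a \<Rightarrow> 'a list \<Rightarrow> nat" where
  "num_subsums_list G g xs =
     card {I. I \<subseteq> {..<length xs} \<and> finprod G (\<lambda>i. xs ! i) I = g}"

definition num_subsums :: "('a, 'b) monoid_scheme \<Rightarrow> 'a \<Rightarrow> 'a multiset \<Rightarrow> nat" where
  "num_subsums G g S = num_subsums_list G g (SOME xs. mset xs = S)"

definition davenport :: "('a, 'b) monoid_scheme \<Rightarrow> nat" where
  "davenport G = (LEAST l. 0 < l \<and>
     (\<forall>S. seq_over G S \<and> l \<le> size S \<longrightarrow>
        (\<exists>T. T \<subseteq># S \<and> T \<noteq> {#} \<and> seq_sum G T = \<one>\<^bsub>G\<^esub>)))"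

definition minimal_zero_sum :: "('a, 'b) monoid_scheme \<Rightarrow> 'a multiset \<Rightarrow> bool" where
  "minimal_zero_sum G T \<longleftrightarrow> seq_over G T \<and> T \<noteq> {#} \<and> seq_sum G T = \<one>\<^bsub>G\<^esub> \<and>
     (\<forall>U. U \<subset># T \<and> U \<noteq> {#} \<longrightarrow> seq_sum G U \<noteq> \<one>\<^bsub>G\<^esub>)"

text \<open>
  The exponent \<open>|S| - D(G) + 1\<close> is an integer which is negative if \<open>|S| < D(G) - 1\<close>. In that
  case the equation below is false, whereas truncated subtraction would make it hold for short
  sequences without nonempty zero-sum subsequences.
\<close>

definition attains_bound :: "('a, 'b) monoid_scheme \<Rightarrow> 'a \<Rightarrow> 'a multiset \<Rightarrow> bool" where
  "attains_bound G g S \<longleftrightarrow>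
     real (num_subsums G g S) = 2 powi (int (size S) - int (davenport G) + 1)"

definition extremal_set :: "('a, 'b) monoid_scheme \<Rightarrow> 'a multiset \<Rightarrow> 'a set" where
  "extremal_set G S = {g \<in> carrier G. attains_bound G g S}"

definition extremal_seqs_disjoint :: "('a, 'b) monoid_scheme \<Rightarrow> bool" where
  "extremal_seqs_disjoint G \<longleftrightarrow>
     (\<forall>S. seq_over G S \<and> \<one>\<^bsub>G\<^esub> \<notin># S \<and> attains_bound G \<one>\<^bsub>G\<^esub> S \<longrightarrow>
        int (card {T. T \<subseteq># S \<and> minimal_zero_sum G T}) = int (size S) - int (davenport G) + 1 \<and>
        (\<forall>T U. T \<subseteq># S \<and> minimal_zero_sum G T \<and> U \<subseteq># S \<and> minimal_zero_sum G U \<and> T \<noteq> U \<longrightarrow>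
           T \<inter># U = {#}))"

definition extremal_seqs_bounded :: "('a, 'b) monoid_scheme \<Rightarrow> bool" where
  "extremal_seqs_bounded G \<longleftrightarrow>
     (\<exists>t::nat. \<forall>S. seq_over G S \<and> \<one>\<^bsub>G\<^esub> \<notin># S \<and> attains_bound G \<one>\<^bsub>G\<^esub> S \<longrightarrow> size S \<le> t)"

definition davenport_quotient_gap :: "('a, 'b) monoid_scheme \<Rightarrow> bool" where
  "davenport_quotient_gap G \<longleftrightarrow>
     (\<forall>H. subgroup H G \<and> G\<lparr>carrier := H\<rparr> \<cong> integer_mod_group 2 \<longrightarrow>
        davenport G \<ge> davenport (G Mod H) + 2)"

definition extremal_sets_no_subgroup :: "('a, 'b) monoid_scheme \<Rightarrow> bool" where
  "extremal_sets_no_subgroup G \<longleftrightarrow>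
     (\<forall>S. seq_over G S \<and> size S \<ge> davenport G - 1 \<longrightarrow>
        \<not> (\<exists>H. subgroup H G \<and> H \<noteq> {\<one>\<^bsub>G\<^esub>} \<and> H \<subseteq> extremal_set G S))"

lemma (in comm_monoid) num_subsums_list_cong_mset:
  assumes "mset xs = mset ys" and "set ys \<subseteq> carrier G"
  shows "num_subsums_list G g xs = num_subsums_list G g ys"
proof -
  obtain f where f: "bij_betw f {..<length xs} {..<length ys}"
    and nth: "\<And>i. i < length xs \<Longrightarrow> xs ! i = ys ! f i"
    using permutation_Ex_bij[OF assms(1)] by blast
  have prod_eq: "finprod G (\<lambda>i. ys ! i) (f ` I) = finprod G (\<lambda>i. xs ! i) I"
    if I: "I \<subseteq> {..<length xs}" for I
  proof -
    have inj: "inj_on f I"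
      using f I by (meson bij_betw_imp_inj_on inj_on_subset)
    have sub: "f ` I \<subseteq> {..<length ys}"
      using f I by (metis bij_betw_imp_surj_on image_mono)
    have "(\<lambda>i. ys ! i) \<in> f ` I \<rightarrow> carrier G"
    proof
      fix j assume "j \<in> f ` I"
      then have "j < length ys" using sub by auto
      then show "ys ! j \<in> carrier G" using assms(2) nth_mem by blast
    qed
    then have "finprod G (\<lambda>i. ys ! i) (f ` I) = finprod G (\<lambda>i. ys ! f i) I"
      using inj by (rule finprod_reindex)
    also have "\<dots> = finprod G (\<lambda>i. xs ! i) I"
    proof (rule finprod_cong')
      show "(\<lambda>i. xs ! i) \<in> I \<rightarrow> carrier G"
      proof
        fix i assume "i \<in> I"
        then have "i < length xs" using I by auto
        then have "xs ! i \<in> set xs" by simp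
        also have "set xs = set ys" using assms(1) by (rule mset_eq_setD)
        finally show "xs ! i \<in> carrier G" using assms(2) by blast
      qed
      show "ys ! f i = xs ! i" if "i \<in> I" for i
        using nth[of i] I that by auto
    qed simp
    finally show ?thesis .
  qed
  let ?A = "{I. I \<subseteq> {..<length xs} \<and> finprod G (\<lambda>i. xs ! i) I = g}"
  let ?B = "{I. I \<subseteq> {..<length ys} \<and> finprod G (\<lambda>i. ys ! i) I = g}"
  have bij: "bij_betw (image f) (Pow {..<length xs}) (Pow {..<length ys})"
    using f by (rule bij_betw_Pow)
  have img: "image f ` ?A = ?B"
  proof
    show "image f ` ?A \<subseteq> ?B"
    proof
      fix J assume "J \<in> image f ` ?A"
      then obtain I where I: "I \<subseteq> {..<length xs}" "finprod G (\<lambda>i. xs ! i) I = g" "J = f ` I"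
        by blast
      have "f ` I \<subseteq> {..<length ys}"
        using f I(1) by (metis bij_betw_imp_surj_on image_mono)
      then show "J \<in> ?B" using prod_eq[OF I(1)] I by simp
    qed
    show "?B \<subseteq> image f ` ?A"
    proof
      fix J assume J: "J \<in> ?B"
      then have "J \<in> image f ` Pow {..<length xs}"
        using bij by (simp add: bij_betw_def)
      then obtain I where I: "I \<subseteq> {..<length xs}" "J = f ` I" by blast
      then have "I \<in> ?A" using J prod_eq[OF I(1)] by simp
      then show "J \<in> image f ` ?A" using I(2) by blast
    qed
  qed
  have "inj_on (image f) ?A"
    by (rule inj_on_subset[OF bij_betw_imp_inj_on[OF bij]]) blast
  then have "card (image f ` ?A) = card ?A"
    by (rule card_image)
  then have "card ?A = card ?B"
    unfolding img by (rule sym)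
  then show ?thesis by (simp add: num_subsums_list_def)
qed

lemma (in comm_monoid) num_subsums_mset:
  assumes "set xs \<subseteq> carrier G"
  shows "num_subsums G g (mset xs) =
    card {I. I \<subseteq> {..<length xs} \<and> finprod G (\<lambda>i. xs ! i) I = g}"
proof -
  have "mset (SOME ys. mset ys = mset xs) = mset xs"
    by (rule someI[of "\<lambda>ys. mset ys = mset xs" xs]) simp
  from num_subsums_list_cong_mset[OF this assms] show ?thesis
    unfolding num_subsums_def by (simp only: num_subsums_list_def[of G g xs])
qed

end

theory Submission
  imports Defs
begin

text \<open>
  Every \<open>N\<^sub>g(S)\<close> is \<open>0\<close> or at least \<open>2\<^bsup>|S|-D(G)+1\<^esup>\<close>. (i) \<open>\<Longrightarrow>\<close> (ii): \<open>|S| - D(G) + 1\<close> disjoint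
  zero-sum subsequences of length at least \<open>2\<close> force \<open>|S| \<le> 2 D(G) - 2\<close>. The three equivalences form
  the cycle (ii) \<open>\<Longrightarrow>\<close> (iii) \<open>\<Longrightarrow>\<close> (iv) \<open>\<Longrightarrow>\<close> (ii). For the last implication, a long extremal \<open>S\<close> contains
  some \<open>x \<noteq> 0\<close> many times; since \<open>N\<^sub>g(S) = N\<^sub>g(S x\<^sup>-\<^sup>1) + N\<^bsub>g-x\<^esub>(S x\<^sup>-\<^sup>1)\<close>, after removing \<open>j\<close> copies of \<open>x\<close>
  the elements \<open>0, -x, \<dots>, -j x\<close> are all extremal, and eventually these fill the subgroup generated by \<open>x\<close>.
\<close>

section \<open>Multisets\<close>

text \<open>Pigeonhole. It serves twice: to see that the Davenport constant exists, and to find a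
  term that a long extremal sequence repeats often.\<close>

lemma exists_large_multiplicity:
  assumes "finite A" "set_mset S \<subseteq> A" "card A * k < size S"
  shows "\<exists>x\<in>#S. k < count S x"
proof (rule ccontr)
  assume "\<not> ?thesis"
  then have le: "count S x \<le> k" if "x \<in># S" for x using that by (meson not_less)
  have "size S \<le> card (set_mset S) * k"
    unfolding size_multiset_overloaded_eq using sum_bounded_above[of "set_mset S" "count S" k] le
    by simp
  also have "\<dots> \<le> card A * k" using assms by (simp add: card_mono)
  finally show False using assms(3) by simp
qed

lemma finite_submultisets: "finite {T. T \<subseteq># S}"
proof (rule finite_subset)
  show "{T. T \<subseteq># S} \<subseteq> mset ` {xs. set xs \<subseteq> set_mset S \<and> length xs \<le> size S}"
  proof
    fix T assume "T \<in> {T. T \<subseteq># S}"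
    then have T: "T \<subseteq># S" by simp
    obtain xs where "mset xs = T" using ex_mset by blast
    then show "T \<in> mset ` {xs. set xs \<subseteq> set_mset S \<and> length xs \<le> size S}"
      using set_mset_mono[OF T] size_mset_mono[OF T] by force
  qed
qed (simp add: finite_lists_length_le)

text \<open>Each element occurs in at most one member of \<open>A\<close>, so multiplicities do not
  accumulate. Comparing sizes then bounds the total length of the members by |S|.\<close>

lemma disjoint_submultisets_sum:
  assumes "finite A" "\<And>T. T \<in> A \<Longrightarrow> T \<subseteq># S"
    and "\<And>T U. T \<in> A \<Longrightarrow> U \<in> A \<Longrightarrow> T \<noteq> U \<Longrightarrow> T \<inter># U = {#}"
  shows "(\<Sum>T\<in>A. T) \<subseteq># S"
  using assms
proof (induction A rule: finite_induct)
  case empty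
  then show ?case by simp
next
  case (insert T F)
  have F: "(\<Sum>T\<in>F. T) \<subseteq># S" and T: "T \<subseteq># S" using insert by auto
  have "count T x + count (\<Sum>T\<in>F. T) x \<le> count S x" for x
  proof (cases "x \<in># T")
    case True
    have "count U x = 0" if "U \<in> F" for U
    proof -
      have "T \<inter># U = {#}" using that insert.hyps insert.prems(2) by blast
      then show ?thesis using True by (metis disjunct_not_in not_in_iff)
    qed
    then have "count (\<Sum>T\<in>F. T) x = 0" by (simp add: count_sum)
    then show ?thesis using T by (simp add: mset_subset_eq_count)
  next
    case False
    then show ?thesis using F by (simp add: mset_subset_eq_count not_in_iff)
  qed
  then show ?case using insert.hyps by (simp add: mset_subset_eqI)
qed

section \<open>Sums of sequences\<close>

lemma seq_over_empty [simp]: "seq_over G {#}"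
  by (simp add: seq_over_def)

lemma seq_over_add [simp]: "seq_over G (add_mset x S) \<longleftrightarrow> x \<in> carrier G \<and> seq_over G S"
  by (simp add: seq_over_def)

lemma seq_over_union [simp]: "seq_over G (S + T) \<longleftrightarrow> seq_over G S \<and> seq_over G T"
  by (auto simp: seq_over_def)

lemma seq_over_subset: "seq_over G S \<Longrightarrow> T \<subseteq># S \<Longrightarrow> seq_over G T"
  unfolding seq_over_def by (meson mset_subset_eqD subset_iff)

lemma seq_over_replicate: "x \<in> carrier G \<Longrightarrow> seq_over G (replicate_mset k x)"
  by (induction k) auto

definition zero_sum_free :: "('a, 'b) monoid_scheme \<Rightarrow> 'a multiset \<Rightarrow> bool" where
  "zero_sum_free G S \<longleftrightarrow> (\<forall>T. T \<subseteq># S \<and> T \<noteq> {#} \<longrightarrow> seq_sum G T \<noteq> \<one>\<^bsub>G\<^esub>)"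

lemma zero_sum_free_subset: "zero_sum_free G S \<Longrightarrow> T \<subseteq># S \<Longrightarrow> zero_sum_free G T"
  unfolding zero_sum_free_def by (meson subset_mset.order_trans)

context comm_group
begin

lemma seq_sum_empty [simp]: "seq_sum G {#} = \<one>"
  by (simp add: seq_sum_def)

lemma seq_sum_closed [simp]: "seq_over G S \<Longrightarrow> seq_sum G S \<in> carrier G"
  unfolding seq_sum_def seq_over_def by (rule finprod_closed) auto

text \<open>With \<open>x\<close> split off from the support, new and repeated terms are treated
  alike: only the exponent of \<open>x\<close> changes.\<close>

lemma seq_sum_add [simp]:
  assumes "x \<in> carrier G" "seq_over G S"
  shows "seq_sum G (add_mset x S) = x \<otimes> seq_sum G S"
proof -
  define A where "A = set_mset S - {x}"
  have A: "finite A" "x \<notin> A" "A \<subseteq> carrier G"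
    using assms by (auto simp: A_def seq_over_def)
  have S: "seq_sum G S = x [^] count S x \<otimes> finprod G (\<lambda>y. y [^] count S y) A"
  proof (cases "x \<in># S")
    case True
    then have eq: "set_mset S = insert x A" by (auto simp: A_def)
    show ?thesis unfolding seq_sum_def eq
      using A assms(1) by (intro finprod_insert) auto
  next
    case False
    then have "set_mset S = A" by (auto simp: A_def)
    moreover have "count S x = 0" using False by (simp add: not_in_iff)
    moreover have "finprod G (\<lambda>y. y [^] count S y) A \<in> carrier G"
      using A by (intro finprod_closed) auto
    ultimately show ?thesis by (simp add: seq_sum_def)
  qed
  have eq: "set_mset (add_mset x S) = insert x A" by (auto simp: A_def)
  have "seq_sum G (add_mset x S)
      = x [^] count (add_mset x S) x \<otimes> finprod G (\<lambda>y. y [^] count (add_mset x S) y) A"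
    unfolding seq_sum_def eq using A assms(1) by (intro finprod_insert) auto
  also have "finprod G (\<lambda>y. y [^] count (add_mset x S) y) A = finprod G (\<lambda>y. y [^] count S y) A"
    using A by (intro finprod_cong') auto
  also have "x [^] count (add_mset x S) x = x \<otimes> x [^] count S x"
    using assms(1) by (simp add: m_comm)
  also have "x \<otimes> x [^] count S x \<otimes> finprod G (\<lambda>y. y [^] count S y) A = x \<otimes> seq_sum G S"
    unfolding S using A assms(1) by (intro m_assoc finprod_closed) auto
  finally show ?thesis .
qed

lemma seq_sum_union [simp]:
  assumes "seq_over G S" "seq_over G T"
  shows "seq_sum G (S + T) = seq_sum G S \<otimes> seq_sum G T"
  using assms by (induction S) (auto simp: m_assoc)

lemma seq_sum_replicate [simp]:
  assumes "x \<in> carrier G"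
  shows "seq_sum G (replicate_mset k x) = x [^] k"
  using assms seq_over_replicate[OF assms] by (induction k) (auto simp: m_comm)

section \<open>Counting index sets with a given sum\<close>

lemma num_subsums_empty: "num_subsums G g {#} = (if g = \<one> then 1 else 0)"
proof -
  have "num_subsums G g (mset []) = card {I::nat set. I \<subseteq> {} \<and> finprod G (\<lambda>i. [] ! i) I = g}"
    using num_subsums_mset[of "[]" g] by simp
  also have "{I::nat set. I \<subseteq> {} \<and> finprod G (\<lambda>i. [] ! i) I = g} = (if g = \<one> then {{}} else {})"
    by auto
  finally show ?thesis by simp
qed

text \<open>Index sets are sorted by whether they contain the last index; deleting it from those
  that do leaves index sets with sum g - x. All later counting rests on this recursion.\<close>

lemma num_subsums_add:
  assumes "x \<in> carrier G" "seq_over G S" "g \<in> carrier G"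
  shows "num_subsums G g (add_mset x S) = num_subsums G g S + num_subsums G (g \<otimes> inv x) S"
proof -
  obtain xs where xs: "mset xs = S" using ex_mset by blast
  have c: "set xs \<subseteq> carrier G" using assms(2) xs by (auto simp: seq_over_def)
  let ?n = "length xs" and ?ys = "xs @ [x]"
  let ?F = "\<lambda>g. {I. I \<subseteq> {..<?n} \<and> finprod G (\<lambda>i. xs ! i) I = g}"
  have cl: "(\<lambda>i. xs ! i) \<in> I \<rightarrow> carrier G" if "I \<subseteq> {..<?n}" for I
    using that c nth_mem by (fastforce simp: subset_iff)
  have old: "finprod G (\<lambda>i. ?ys ! i) I = finprod G (\<lambda>i. xs ! i) I" if I: "I \<subseteq> {..<?n}" for I
    by (rule finprod_cong'[OF refl cl[OF I]]) (use I in \<open>auto simp: nth_append\<close>)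
  have new: "finprod G (\<lambda>i. ?ys ! i) (insert ?n I) = x \<otimes> finprod G (\<lambda>i. xs ! i) I"
    if I: "I \<subseteq> {..<?n}" for I
  proof -
    have "finprod G (\<lambda>i. ?ys ! i) (insert ?n I) = ?ys ! ?n \<otimes> finprod G (\<lambda>i. ?ys ! i) I"
    proof (rule finprod_insert)
      show "finite I" using I finite_subset by blast
      show "?n \<notin> I" using I by auto
      show "(\<lambda>i. ?ys ! i) \<in> I \<rightarrow> carrier G"
        using cl[OF I] I by (auto simp: nth_append Pi_iff)
      show "?ys ! ?n \<in> carrier G" using assms(1) by simp
    qed
    then show ?thesis using old[OF I] by simp
  qed
  have solve: "x \<otimes> y = g \<longleftrightarrow> y = g \<otimes> inv x" if "y \<in> carrier G" for y
    using that assms(1,3) by (metis inv_solve_right m_comm)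
  have split: "{I. I \<subseteq> {..<length ?ys} \<and> finprod G (\<lambda>i. ?ys ! i) I = g}
      = ?F g \<union> insert ?n ` ?F (g \<otimes> inv x)" (is "?L = ?R")
  proof (rule Set.set_eqI)
    fix I
    show "I \<in> ?L \<longleftrightarrow> I \<in> ?R"
    proof (cases "?n \<in> I")
      case False
      then have "I \<subseteq> {..<length ?ys} \<longleftrightarrow> I \<subseteq> {..<?n}"
        by (auto simp: less_Suc_eq)
      then show ?thesis using False old by auto
    next
      case True
      define J where "J = I - {?n}"
      have I: "I = insert ?n J" and nJ: "?n \<notin> J" using True by (auto simp: J_def)
      have sub: "I \<subseteq> {..<length ?ys} \<longleftrightarrow> J \<subseteq> {..<?n}"
        using nJ unfolding I by (auto simp: less_Suc_eq)
      have inj: "J' = J" if "insert ?n J' = I" "J' \<subseteq> {..<?n}" for J'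
      proof -
        have "?n \<notin> J'" using that(2) by auto
        then show ?thesis using that(1) nJ by (simp add: I insert_ident)
      qed
      have "I \<in> ?R \<longleftrightarrow> J \<in> ?F (g \<otimes> inv x)"
      proof
        assume "I \<in> ?R"
        moreover have "I \<notin> ?F g" using True by auto
        ultimately obtain J' where "I = insert ?n J'" "J' \<in> ?F (g \<otimes> inv x)" by blast
        then show "J \<in> ?F (g \<otimes> inv x)" using inj[of J'] by simp
      next
        assume "J \<in> ?F (g \<otimes> inv x)"
        then show "I \<in> ?R" unfolding I by (intro UnI2 imageI)
      qed
      also have "\<dots> \<longleftrightarrow> I \<in> ?L"
        using sub new[of J] solve[OF finprod_closed[OF cl[of J]]] I by auto
      finally show ?thesis by simp
    qed
  qed
  have fin: "finite (?F h)" for h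
    by (rule finite_subset[of _ "Pow {..<?n}"]) auto
  have "num_subsums G g (mset ?ys) = card (?F g \<union> insert ?n ` ?F (g \<otimes> inv x))"
    unfolding split[symmetric] by (rule num_subsums_mset) (use c assms(1) in auto)
  also have "\<dots> = card (?F g) + card (insert ?n ` ?F (g \<otimes> inv x))"
    by (rule card_Un_disjoint) (use fin in auto)
  also have "card (insert ?n ` ?F (g \<otimes> inv x)) = card (?F (g \<otimes> inv x))"
  proof (rule card_image, rule inj_onI)
    fix I J assume "I \<in> ?F (g \<otimes> inv x)" "J \<in> ?F (g \<otimes> inv x)" "insert ?n I = insert ?n J"
    moreover from this have "?n \<notin> I" "?n \<notin> J" by auto
    ultimately show "I = J" by (simp add: insert_ident)
  qed
  finally show ?thesis
    using num_subsums_mset[OF c] xs by simp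
qed

text \<open>A subsequence of the extended sequence either avoids \<open>x\<close> and lies in
  \<open>S\<close>, or consists of \<open>x\<close> and a subsequence of \<open>S\<close> with sum g
  - x. This matches the recursion for the count.\<close>

lemma num_subsums_pos_iff:
  assumes "seq_over G S" "g \<in> carrier G"
  shows "0 < num_subsums G g S \<longleftrightarrow> (\<exists>T. T \<subseteq># S \<and> seq_sum G T = g)"
  using assms
proof (induction S arbitrary: g)
  case empty
  then show ?case by (auto simp: num_subsums_empty)
next
  case (add x S)
  then have c: "x \<in> carrier G" "seq_over G S" "g \<otimes> inv x \<in> carrier G" by auto
  have "(\<exists>T. T \<subseteq># add_mset x S \<and> seq_sum G T = g) \<longleftrightarrow>
      (\<exists>T. T \<subseteq># S \<and> seq_sum G T = g) \<or> (\<exists>T. T \<subseteq># S \<and> seq_sum G T = g \<otimes> inv x)"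
    (is "?L \<longleftrightarrow> ?A \<or> ?B")
  proof
    assume ?L
    then obtain T where T: "T \<subseteq># add_mset x S" "seq_sum G T = g" by blast
    show "?A \<or> ?B"
    proof (cases "x \<in># T")
      case True
      then obtain U where U: "T = add_mset x U" by (metis mset_add)
      then have "U \<subseteq># S" using T(1) by simp
      moreover from this have "seq_over G U" using c(2) seq_over_subset by blast
      ultimately show ?thesis
        using T(2) U c(1) by (metis inv_solve_right' m_comm seq_sum_add seq_sum_closed add.prems(2))
    next
      case False
      then have "T \<subseteq># S" using T(1) by (metis diff_single_trivial subset_eq_diff_conv add_mset_add_single)
      then show ?thesis using T(2) by blast
    qed
  next
    assume "?A \<or> ?B"
    then show ?L
    proof
      assume ?A
      then show ?L by (metis add_mset_add_single mset_subset_eq_add_left subset_mset.order_trans)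
    next
      assume ?B
      then obtain T where T: "T \<subseteq># S" "seq_sum G T = g \<otimes> inv x" by blast
      then have "seq_over G T" using c(2) seq_over_subset by blast
      then have "seq_sum G (add_mset x T) = g"
        using T(2) c(1) add.prems(2) by (simp add: m_lcomm)
      moreover have "add_mset x T \<subseteq># add_mset x S" using T(1) by simp
      ultimately show ?L by blast
    qed
  qed
  then show ?case
    using add.IH[of g] add.IH[OF c(2,3)] add.prems c num_subsums_add[OF c(1,2) add.prems(2)]
    by auto
qed

text \<open>For a single term \<open>x\<close>, replacing \<open>x\<close> by -x and g by g - x
  merely swaps the two summands of the recursion. \<open>S\<close> is generalised so that the
  current term can be parked there while the rest of \<open>T\<close> is inverted. If
  \<open>T\<close> has sum g, the right side is an N_0.\<close>

lemma num_subsums_flip: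
  assumes "seq_over G S" "seq_over G T" "g \<in> carrier G"
  shows "num_subsums G g (T + S)
    = num_subsums G (g \<otimes> inv (seq_sum G T)) (image_mset (\<lambda>x. inv x) T + S)"
  using assms
proof (induction T arbitrary: g S)
  case empty
  then show ?case by simp
next
  case (add x T)
  let ?iT = "image_mset (\<lambda>x. inv x) T"
  have c: "x \<in> carrier G" "seq_over G T" using add.prems by auto
  have iT: "seq_over G ?iT" using c(2) by (auto simp: seq_over_def)
  let ?h = "g \<otimes> inv (seq_sum G T)"
  have h: "?h \<in> carrier G" using c add.prems by simp
  have "num_subsums G g (T + add_mset x S) = num_subsums G ?h (?iT + add_mset x S)"
    by (rule add.IH) (use add.prems in auto)
  also have "\<dots> = num_subsums G ?h (add_mset x (?iT + S))" by simp
  also have "\<dots> = num_subsums G ?h (?iT + S) + num_subsums G (?h \<otimes> inv x) (?iT + S)"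
    by (rule num_subsums_add) (use c iT h add.prems in auto)
  also have "\<dots> = num_subsums G (?h \<otimes> inv x) (add_mset (inv x) (?iT + S))"
    using num_subsums_add[of "inv x" "?iT + S" "?h \<otimes> inv x"] c iT h add.prems
    by (simp add: m_assoc)
  also have "?h \<otimes> inv x = g \<otimes> inv (seq_sum G (add_mset x T))"
    using c add.prems by (simp add: inv_mult m_comm m_lcomm)
  finally show ?case by simp
qed

text \<open>A subsequence of \<open>S\<close> with sum -x would complete to a zero-sum subsequence
  once \<open>x\<close> is added, so adding a term never creates a new index set for 0.\<close>

lemma num_subsums_zero_sum_free:
  assumes "seq_over G S" "zero_sum_free G S"
  shows "num_subsums G \<one> S = 1"
  using assms
proof (induction S)
  case empty
  then show ?case by (simp add: num_subsums_empty)
next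
  case (add x S)
  have c: "x \<in> carrier G" "seq_over G S" using add.prems by auto
  have "zero_sum_free G S" using add.prems(2) by (rule zero_sum_free_subset) simp
  then have 1: "num_subsums G \<one> S = 1" using add.IH c by blast
  have "\<not> 0 < num_subsums G (inv x) S"
  proof
    assume "0 < num_subsums G (inv x) S"
    then obtain T where T: "T \<subseteq># S" "seq_sum G T = inv x"
      using num_subsums_pos_iff c by auto
    then have "seq_over G T" using c(2) seq_over_subset by blast
    then have "seq_sum G (add_mset x T) = \<one>" using T c by simp
    moreover have "add_mset x T \<subseteq># add_mset x S" using T(1) by simp
    ultimately show False
      using add.prems(2)[unfolded zero_sum_free_def, rule_format, of "add_mset x T"] by simp
  qed
  then show ?case using num_subsums_add[OF c one_closed] 1 c by simp
qed

section \<open>The Davenport constant\<close>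

text \<open>By Lagrange, |G| copies of \<open>x\<close> have sum 0. That \<open>x\<close> belongs to
  \<open>T\<close> matters later, where one copy of it is deleted to reach the sum -x.\<close>

lemma replicate_zero_sum_exists:
  assumes "finite (carrier G)" "seq_over G S" "order G \<le> count S x" "x \<in># S"
  shows "\<exists>T. T \<subseteq># S \<and> T \<noteq> {#} \<and> x \<in># T \<and> seq_sum G T = \<one>"
proof (intro exI conjI)
  have x: "x \<in> carrier G" using assms by (auto simp: seq_over_def)
  have "0 < order G" using assms(1) order_gt_0_iff_finite by blast
  then show "replicate_mset (order G) x \<noteq> {#}" "x \<in># replicate_mset (order G) x" by auto
  show "replicate_mset (order G) x \<subseteq># S" using assms(3) by (simp add: count_le_replicate_mset_subset_eq)
  show "seq_sum G (replicate_mset (order G) x) = \<one>" using x by (simp add: pow_order_eq_1)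
qed

text \<open>For \<open>LEAST\<close> to be meaningful, some length must force a zero-sum
  subsequence. Beyond |G|^2 terms some element occurs more than |G| times, and |G| copies of it
  suffice.\<close>

lemma
  assumes "finite (carrier G)"
  shows davenport_pos: "0 < davenport G"
    and davenport_zero_sum: "\<And>S. seq_over G S \<Longrightarrow> davenport G \<le> size S \<Longrightarrow>
      \<exists>T. T \<subseteq># S \<and> T \<noteq> {#} \<and> seq_sum G T = \<one>"
proof -
  let ?P = "\<lambda>l. 0 < l \<and> (\<forall>S. seq_over G S \<and> l \<le> size S \<longrightarrow>
        (\<exists>T. T \<subseteq># S \<and> T \<noteq> {#} \<and> seq_sum G T = \<one>))"
  have "?P (Suc (order G * order G))"
  proof (intro conjI allI impI)
    fix S assume S: "seq_over G S \<and> Suc (order G * order G) \<le> size S"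
    then obtain x where "x \<in># S" "order G < count S x"
      using exists_large_multiplicity[OF assms, of S "order G"]
      by (auto simp: seq_over_def order_def)
    then show "\<exists>T. T \<subseteq># S \<and> T \<noteq> {#} \<and> seq_sum G T = \<one>"
      using replicate_zero_sum_exists[OF assms] S by (meson less_imp_le)
  qed simp
  then have P: "?P (davenport G)" unfolding davenport_def by (rule LeastI)
  then show "0 < davenport G" by blast
  show "\<exists>T. T \<subseteq># S \<and> T \<noteq> {#} \<and> seq_sum G T = \<one>"
    if "seq_over G S" "davenport G \<le> size S" for S using P that by blast
qed

lemma zero_sum_free_size:
  assumes "finite (carrier G)" "seq_over G S" "zero_sum_free G S"
  shows "size S < davenport G"
  using davenport_zero_sum[OF assms(1,2)] assms(3) unfolding zero_sum_free_def
  by (meson not_less)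

text \<open>Minimality of D(G) says that the length D(G) - 1 fails, provided that it is positive.
  For D(G) = 1 it is not a candidate, and the empty sequence takes over.\<close>

lemma exists_zero_sum_free:
  assumes "finite (carrier G)"
  shows "\<exists>S. seq_over G S \<and> zero_sum_free G S \<and> Suc (size S) = davenport G"
proof (cases "davenport G = 1")
  case True
  then show ?thesis by (intro exI[of _ "{#}"]) (simp add: zero_sum_free_def)
next
  case False
  then have "0 < davenport G - 1" "davenport G - 1 < davenport G"
    using davenport_pos[OF assms] by auto
  then obtain S where S: "seq_over G S" "davenport G - 1 \<le> size S" "zero_sum_free G S"
    unfolding zero_sum_free_def
    using not_less_Least[of "davenport G - 1", folded davenport_def] unfolding davenport_def
    by blast
  then show ?thesis using zero_sum_free_size[OF assms S(1,3)] by (intro exI[of _ S]) auto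
qed

text \<open>Olson's bound \<open>N\<^sub>g(S) \<ge> 2\<^bsup>|S|-D(G)+1\<^esup>\<close>, with the denominator cleared. A term lying in a
  zero-sum subsequence splits \<open>N\<^sub>0(S)\<close> into two positive numbers of the same kind, because inverting
  the terms of a subsequence with sum \<open>g\<close> turns \<open>N\<^sub>g\<close> into \<open>N\<^sub>0\<close>.\<close>

lemma num_subsums_lower_bound:
  assumes "finite (carrier G)" "seq_over G S" "g \<in> carrier G" "0 < num_subsums G g S"
  shows "2 ^ size S \<le> num_subsums G g S * 2 ^ (davenport G - 1)"
proof -
  have red: "\<exists>S'. seq_over G S' \<and> size S' = size S \<and> num_subsums G g S = num_subsums G \<one> S'"
    if S: "seq_over G S" and g: "g \<in> carrier G" and pos: "0 < num_subsums G g S" for g S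
  proof -
    obtain T where T: "T \<subseteq># S" "seq_sum G T = g" using num_subsums_pos_iff S g pos by blast
    let ?S' = "image_mset (\<lambda>x. inv x) T + (S - T)"
    have o: "seq_over G T" "seq_over G (S - T)" using S T(1) by (auto intro: seq_over_subset)
    have "seq_over G ?S'" using o by (auto simp: seq_over_def)
    moreover have "size ?S' = size S" using T(1) by (metis size_image_mset size_union subset_mset.add_diff_inverse)
    moreover have "num_subsums G g S = num_subsums G \<one> ?S'"
      using num_subsums_flip[OF o(2,1) g] T g by simp
    ultimately show ?thesis by blast
  qed
  have zero: "2 ^ size S \<le> num_subsums G \<one> S * 2 ^ (davenport G - 1)" if "seq_over G S" for S
    using that
  proof (induction "size S" arbitrary: S rule: less_induct)
    case less
    show ?case
    proof (cases "davenport G \<le> size S")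
      case False
      \<comment> \<open>For |S| < D(G) the required bound is at most 1, and the empty index set
        already counts.\<close>
      have "0 < num_subsums G \<one> S"
        using num_subsums_pos_iff[OF less.prems one_closed] by (metis empty_le seq_sum_empty)
      moreover have "(2::nat) ^ size S \<le> 2 ^ (davenport G - 1)"
        using False by (intro power_increasing) auto
      ultimately show ?thesis
        by (metis One_nat_def Suc_leI le_trans mult_le_mono1 nat_mult_1)
    next
      case True
      then obtain T where T: "T \<subseteq># S" "T \<noteq> {#}" "seq_sum G T = \<one>"
        using davenport_zero_sum[OF assms(1) less.prems] by blast
      then obtain x U where U: "T = add_mset x U" by (meson multiset_cases)
      then obtain R where R: "S = add_mset x R" using T(1) by (metis mset_add mset_subset_eqD union_single_eq_member)
      have c: "x \<in> carrier G" "seq_over G R" "U \<subseteq># R" using less.prems R U T(1) by auto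
      then have "seq_over G U" using seq_over_subset by blast
      then have "seq_sum G U = inv x"
        using T(3) U c by (metis comm_inv_char seq_sum_add seq_sum_closed)
      then have "0 < num_subsums G (inv x) R" using num_subsums_pos_iff c by blast
      then obtain R' where R': "seq_over G R'" "size R' = size R"
        "num_subsums G (inv x) R = num_subsums G \<one> R'" using red c by blast
      have "2 ^ size R \<le> num_subsums G \<one> R * 2 ^ (davenport G - 1)"
        by (rule less.hyps) (use R c in auto)
      moreover have "2 ^ size R' \<le> num_subsums G \<one> R' * 2 ^ (davenport G - 1)"
        by (rule less.hyps) (use R R' in auto)
      moreover have "num_subsums G \<one> S = num_subsums G \<one> R + num_subsums G \<one> R'"
        using num_subsums_add[OF c(1,2) one_closed] R R' c by simp
      ultimately show ?thesis using R R'(2) by (simp add: add_mult_distrib)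
    qed
  qed
  show ?thesis using red[OF assms(2-4)] zero by metis
qed

text \<open>Clearing the denominator turns the real equation into one over the naturals. Negative
  exponents keep their meaning: if |S| < D(G) - 1, both sides are false.\<close>

lemma attains_bound_iff:
  assumes "finite (carrier G)"
  shows "attains_bound G g S \<longleftrightarrow> num_subsums G g S * 2 ^ (davenport G - 1) = 2 ^ size S"
proof -
  have d: "int (davenport G) - 1 = int (davenport G - 1)" using davenport_pos[OF assms] by simp
  have "(2::real) powi (int (size S) - int (davenport G) + 1)
      = 2 powi (int (size S) - int (davenport G - 1))"
    by (rule arg_cong[where f = "\<lambda>i. 2 powi i"]) (use d in linarith)
  also have "\<dots> = 2 ^ size S / 2 ^ (davenport G - 1)"
    by (simp add: power_int_diff)
  finally have eq: "(2::real) powi (int (size S) - int (davenport G) + 1)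
      = 2 ^ size S / 2 ^ (davenport G - 1)" .
  have "attains_bound G g S \<longleftrightarrow>
      real (num_subsums G g S) * 2 ^ (davenport G - 1) = 2 ^ size S"
    unfolding attains_bound_def eq by (simp add: eq_divide_eq)
  also have "\<dots> \<longleftrightarrow> real (num_subsums G g S * 2 ^ (davenport G - 1)) = real (2 ^ size S)" by simp
  finally show ?thesis by (simp only: of_nat_eq_iff)
qed

section \<open>Quotients\<close>

lemma seq_sum_hom:
  assumes "comm_group K" "f \<in> hom G K" "seq_over G S"
  shows "seq_sum K (image_mset f S) = f (seq_sum G S)"
  using assms(3)
proof (induction S)
  case empty
  interpret K: comm_group K by fact
  show ?case using hom_one[OF assms(2)] by (simp add: K.is_group)
next
  case (add x S)
  interpret K: comm_group K by fact
  have "seq_over K (image_mset f S)"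
    using add.prems assms(2) by (auto simp: seq_over_def hom_def)
  then show ?case using add assms(2) by (simp add: hom_mult hom_in_carrier)
qed

context
  fixes H
  assumes H: "subgroup H G"
begin

interpretation Q: comm_group "G Mod H"
  using H by (rule abelian_FactGroup)

interpretation proj: group_hom G "G Mod H" "\<lambda>x. H #> x"
  using normal.r_coset_hom_Mod[OF subgroup_imp_normal[OF H]]
  by (simp add: group_hom_def group_hom_axioms_def is_group Q.is_group)

lemma finite_carrier_quotient: "finite (carrier G) \<Longrightarrow> finite (carrier (G Mod H))"
  by (simp add: carrier_FactGroup)

lemma seq_over_proj: "seq_over G S \<Longrightarrow> seq_over (G Mod H) (image_mset (\<lambda>x. H #> x) S)"
  by (auto simp: seq_over_def carrier_FactGroup)

lemma coset_eq_subgroup_iff: "x \<in> carrier G \<Longrightarrow> H #> x = H \<longleftrightarrow> x \<in> H"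
  using H by (metis coset_join1 coset_join2)

text \<open>An index set has its sum in the coset of g exactly when the sum is h + g for a unique h
  in \<open>H\<close>. Formally, the recursions in G and in G/H run in parallel; for the empty
  sequence the only possible h is -g.\<close>

lemma num_subsums_quotient:
  assumes "finite (carrier G)" "seq_over G S" "g \<in> carrier G"
  shows "num_subsums (G Mod H) (H #> g) (image_mset (\<lambda>x. H #> x) S)
    = (\<Sum>h\<in>H. num_subsums G (h \<otimes> g) S)"
  using assms(2,3)
proof (induction S arbitrary: g)
  case empty
  have sub: "H \<subseteq> carrier G" using H by (rule subgroup.subset)
  then have fin: "finite H" using assms(1) finite_subset by blast
  have "h \<otimes> g = \<one> \<longleftrightarrow> h = inv g" if "h \<in> H" for h
    using that empty sub by (metis inv_equality inv_inv inv_closed subsetD l_inv)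
  then have "(\<Sum>h\<in>H. num_subsums G (h \<otimes> g) {#}) = (\<Sum>h\<in>H. if h = inv g then 1 else 0)"
    by (intro sum.cong) (simp_all add: num_subsums_empty)
  also have "\<dots> = (if inv g \<in> H then 1 else 0)" using fin by simp
  also have "inv g \<in> H \<longleftrightarrow> H #> g = H"
    using empty H by (metis coset_eq_subgroup_iff inv_inv subgroup.m_inv_closed)
  finally show ?case by (simp add: Q.num_subsums_empty)
next
  case (add x S)
  have c: "x \<in> carrier G" "seq_over G S" "g \<otimes> inv x \<in> carrier G" using add.prems by auto
  have "num_subsums (G Mod H) (H #> g) (image_mset (\<lambda>x. H #> x) (add_mset x S))
      = num_subsums (G Mod H) (H #> g) (image_mset (\<lambda>x. H #> x) S)
      + num_subsums (G Mod H) ((H #> g) \<otimes>\<^bsub>G Mod H\<^esub> inv\<^bsub>G Mod H\<^esub> (H #> x)) (image_mset (\<lambda>x. H #> x) S)"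
    using Q.num_subsums_add[OF proj.hom_closed[OF c(1)] seq_over_proj[OF c(2)]
        proj.hom_closed[OF add.prems(2)]] by simp
  also have "(H #> g) \<otimes>\<^bsub>G Mod H\<^esub> inv\<^bsub>G Mod H\<^esub> (H #> x) = H #> (g \<otimes> inv x)"
    using proj.hom_mult[of g "inv x"] proj.hom_inv[OF c(1)] c add.prems by (simp del: mult_FactGroup)
  also have "num_subsums (G Mod H) (H #> g) (image_mset (\<lambda>x. H #> x) S)
      + num_subsums (G Mod H) (H #> (g \<otimes> inv x)) (image_mset (\<lambda>x. H #> x) S)
      = (\<Sum>h\<in>H. num_subsums G (h \<otimes> g) S + num_subsums G (h \<otimes> (g \<otimes> inv x)) S)"
    using add.IH[of g] add.IH[of "g \<otimes> inv x"] c add.prems by (simp add: sum.distrib)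
  also have "\<dots> = (\<Sum>h\<in>H. num_subsums G (h \<otimes> g) (add_mset x S))"
  proof (rule sum.cong[OF refl])
    fix h assume "h \<in> H"
    then have "h \<in> carrier G" using H by (meson subgroup.mem_carrier)
    then show "num_subsums G (h \<otimes> g) S + num_subsums G (h \<otimes> (g \<otimes> inv x)) S
        = num_subsums G (h \<otimes> g) (add_mset x S)"
      using num_subsums_add[OF c(1,2), of "h \<otimes> g"] c add.prems by (simp add: m_assoc)
  qed
  finally show ?case .
qed

lemma num_subsums_quotient_one:
  assumes "finite (carrier G)" "seq_over G S"
  shows "num_subsums (G Mod H) H (image_mset (\<lambda>x. H #> x) S) = (\<Sum>h\<in>H. num_subsums G h S)"
proof -
  have "H #> \<one> = H" using H subgroup.one_closed coset_eq_subgroup_iff by blast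
  moreover have "(\<Sum>h\<in>H. num_subsums G (h \<otimes> \<one>) S) = (\<Sum>h\<in>H. num_subsums G h S)"
    using subgroup.mem_carrier[OF H] by (intro sum.cong) auto
  ultimately show ?thesis using num_subsums_quotient[OF assms one_closed] by simp
qed

lemma seq_lift:
  assumes "seq_over (G Mod H) S'"
  shows "\<exists>S. seq_over G S \<and> image_mset (\<lambda>x. H #> x) S = S'"
  using assms
proof (induction S')
  case empty
  then show ?case by (intro exI[of _ "{#}"]) simp
next
  case (add C S')
  then obtain S where S: "seq_over G S" "image_mset (\<lambda>x. H #> x) S = S'" by auto
  obtain x where "x \<in> carrier G" "C = H #> x" using add.prems by (auto simp: carrier_FactGroup)
  then show ?case using S by (intro exI[of _ "add_mset x S"]) simp
qed

text \<open>Modulo \<open>H\<close> the copies of \<open>h\<close> vanish, so the part of a zero-sum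
  subsequence taken from \<open>S\<close> projects to a zero-sum sequence and must be empty. What
  remains is fewer than \<open>ord h\<close> copies of \<open>h\<close>, whose sum is 0 only if
  there are none.\<close>

lemma zero_sum_free_extend:
  assumes "seq_over G S" "zero_sum_free (G Mod H) (image_mset (\<lambda>x. H #> x) S)"
    and "h \<in> H" "k < ord h"
  shows "zero_sum_free G (S + replicate_mset k h)"
  unfolding zero_sum_free_def
proof (intro allI impI notI, elim conjE)
  fix T assume T: "T \<subseteq># S + replicate_mset k h" "T \<noteq> {#}" "seq_sum G T = \<one>"
  have h: "h \<in> carrier G" using assms(3) H by (meson subgroup.mem_carrier)
  \<comment> \<open>As many terms of \<open>T\<close> as possible are charged to \<open>S\<close>;
    the excess can only consist of copies of \<open>h\<close>.\<close>
  define A where "A = T \<inter># S"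
  define B where "B = T - S"
  have AB: "T = A + B" unfolding A_def B_def by (rule multiset_eqI) simp
  have A: "A \<subseteq># S" by (simp add: A_def)
  have oA: "seq_over G A" using A assms(1) seq_over_subset by blast
  have "B \<subseteq># replicate_mset k h"
    using T(1) unfolding B_def by (simp add: subset_eq_diff_conv add.commute)
  then have le: "size B \<le> k" and "set_mset B \<subseteq> {h}"
    by (metis size_mset_mono size_replicate_mset,
        metis (no_types) set_mset_mono set_mset_replicate_mset_subset empty_subsetI order_trans order_refl)
  then have B: "B = replicate_mset (size B) h" by (simp add: set_mset_subset_singletonD)
  then have sB: "seq_sum G B = h [^] size B" and oB: "seq_over G B"
    using h by (metis seq_sum_replicate, metis seq_over_replicate)
  have pow: "h [^] size B \<in> H"
    using subgroup_int_pow_closed[OF H assms(3), of "int (size B)"] by (simp add: int_pow_int)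
  have "seq_sum G A \<otimes> h [^] size B = \<one>" using T(3) AB oA oB sB by simp
  then have "seq_sum G A = inv (h [^] size B)"
    using h oA by (metis inv_equality nat_pow_closed seq_sum_closed)
  then have "seq_sum G A \<in> H" using pow H by (simp add: subgroup.m_inv_closed)
  then have "seq_sum (G Mod H) (image_mset (\<lambda>x. H #> x) A) = \<one>\<^bsub>G Mod H\<^esub>"
    using seq_sum_hom[OF Q.comm_group_axioms proj.homh oA] oA coset_eq_subgroup_iff by simp
  moreover have "image_mset (\<lambda>x. H #> x) A \<subseteq># image_mset (\<lambda>x. H #> x) S"
    using A by (rule image_mset_subseteq_mono)
  ultimately have "A = {#}" using assms(2) unfolding zero_sum_free_def by (metis image_mset_is_empty_iff)
  then have "h [^] size B = \<one>" "size B \<noteq> 0" using T AB sB by auto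
  then show False using le assms(4) h by (metis pow_eq_id dvd_imp_le le_less_trans not_less neq0_conv)
qed

text \<open>Lift a longest zero-sum free sequence over G/H and append \<open>ord h - 1\<close>
  copies of \<open>h\<close>: the result is zero-sum free of length D(G/H) + ord(h) - 2.\<close>

lemma davenport_quotient:
  assumes "finite (carrier G)" "h \<in> H"
  shows "davenport (G Mod H) + ord h \<le> Suc (davenport G)"
proof -
  obtain S' where S': "seq_over (G Mod H) S'" "zero_sum_free (G Mod H) S'"
    "Suc (size S') = davenport (G Mod H)"
    using Q.exists_zero_sum_free finite_carrier_quotient[OF assms(1)] by blast
  obtain S where S: "seq_over G S" "image_mset (\<lambda>x. H #> x) S = S'" using seq_lift[OF S'(1)] by blast
  have h: "h \<in> carrier G" using assms(2) H by (meson subgroup.mem_carrier)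
  then have o: "ord h \<ge> 1" using assms(1) ord_ge_1 by blast
  then have "zero_sum_free G (S + replicate_mset (ord h - 1) h)"
    using zero_sum_free_extend[OF S(1) _ assms(2), of "ord h - 1"] S' S(2) by simp
  then have "size (S + replicate_mset (ord h - 1) h) < davenport G"
    using S(1) h by (intro zero_sum_free_size[OF assms(1)]) (simp_all add: seq_over_replicate)
  moreover have "size S = size S'" using S(2) by (metis size_image_mset)
  ultimately show ?thesis using S'(3) o by simp
qed

end

section \<open>Subgroups of order two\<close>

lemma subgroup_order_two:
  assumes "subgroup H G" "card H = 2"
  obtains h where "h \<in> carrier G" "h \<noteq> \<one>" "H = {\<one>, h}" "h \<otimes> h = \<one>" "inv h = h" "ord h = 2"
proof -
  obtain h where h: "H = {\<one>, h}" "h \<noteq> \<one>"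
    using assms subgroup.one_closed[OF assms(1)] by (metis card_2_iff insert_commute insertE singletonD)
  then have hG: "h \<in> carrier G" using subgroup.subset[OF assms(1)] by blast
  have "h \<otimes> h \<in> H" using h subgroup.m_closed[OF assms(1)] by blast
  then have hh: "h \<otimes> h = \<one>" using h hG by (metis insertE l_cancel_one singletonD)
  have "h [^] (2::nat) = \<one>" using hh hG by (simp add: numeral_2_eq_2)
  then have "ord h dvd 2" using pow_eq_id hG by blast
  moreover have "ord h \<noteq> 1" using ord_eq_1 hG h by blast
  ultimately have "ord h = 2" using prime_nat_iff two_is_prime_nat by blast
  then show thesis using that hG h hh by (simp add: inv_equality)
qed

lemma iso_integer_mod_group_two_iff:
  assumes "subgroup H G"
  shows "G\<lparr>carrier := H\<rparr> \<cong> integer_mod_group 2 \<longleftrightarrow> card H = 2"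
proof
  assume "G\<lparr>carrier := H\<rparr> \<cong> integer_mod_group 2"
  then have "card (carrier (G\<lparr>carrier := H\<rparr>)) = card (carrier (integer_mod_group 2))"
    by (rule iso_same_card)
  then show "card H = 2" by (simp add: carrier_integer_mod_group)
next
  assume "card H = 2"
  then obtain h where h: "h \<in> carrier G" "h \<noteq> \<one>" "H = {\<one>, h}" "h \<otimes> h = \<one>"
    using subgroup_order_two[OF assms] by metis
  have "(\<lambda>x. if x = \<one> then 0 else 1) \<in> iso (G\<lparr>carrier := H\<rparr>) (integer_mod_group 2)"
    using h unfolding iso_def hom_def bij_betw_def
    by (auto simp: carrier_integer_mod_group inj_on_def)
  then show "G\<lparr>carrier := H\<rparr> \<cong> integer_mod_group 2" unfolding is_iso_def by blast
qed

section \<open>Extremal sequences\<close>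

lemma disjoint_imp_bounded:
  assumes "extremal_seqs_disjoint G"
  shows "extremal_seqs_bounded G"
  unfolding extremal_seqs_bounded_def
proof (intro exI allI impI, elim conjE)
  fix S assume S: "seq_over G S" "\<one> \<notin># S" "attains_bound G \<one> S"
  define A where "A = {T. T \<subseteq># S \<and> minimal_zero_sum G T}"
  have card: "int (card A) = int (size S) - int (davenport G) + 1"
    using assms S unfolding extremal_seqs_disjoint_def A_def by blast
  have disj: "T \<inter># U = {#}" if "T \<in> A" "U \<in> A" "T \<noteq> U" for T U
    using assms S that unfolding extremal_seqs_disjoint_def A_def by blast
  have fin: "finite A"
    by (rule finite_subset[OF _ finite_submultisets[of S]]) (auto simp: A_def)
  \<comment> \<open>A zero-sum subsequence with a single term would be the term 0, which is
    excluded.\<close>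
  have two: "2 \<le> size T" if "T \<in> A" for T
  proof (rule ccontr)
    assume "\<not> 2 \<le> size T"
    moreover have T: "T \<noteq> {#}" "seq_sum G T = \<one>" "T \<subseteq># S"
      using that by (auto simp: A_def minimal_zero_sum_def)
    ultimately have "size T = 1" by (metis One_nat_def Suc_1 Suc_leI nonempty_has_size nat_less_le)
    then obtain x where x: "T = {#x#}" by (metis size_1_singleton_mset)
    then have "x \<in># S" using T(3) by (simp add: mset_subset_eqD)
    moreover from this have "x = \<one>" using x T(2) S(1) by (auto simp: seq_over_def)
    ultimately show False using S(2) by simp
  qed
  have "2 * card A \<le> (\<Sum>T\<in>A. size T)"
    using sum_mono[of A "\<lambda>_. 2" size] two by simp
  also have "\<dots> = size (\<Sum>T\<in>A. T)" by (simp add: size_multiset_sum)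
  also have "\<dots> \<le> size S"
    using disjoint_submultisets_sum[OF fin, of S] disj by (intro size_mset_mono) (auto simp: A_def)
  \<comment> \<open>The inequality 2(|S| - D(G) + 1) <= |S| gives slightly more than is
    claimed.\<close>
  finally show "size S \<le> 2 * davenport G" using card by linarith
qed

text \<open>If \<open>D(G) = D(G/H) + 1\<close> for \<open>H = {0, h}\<close>, lift a longest zero-sum free sequence over \<open>G/H\<close>
  and append arbitrarily many copies of \<open>h\<close>.\<close>

lemma bounded_imp_quotient_gap:
  assumes "finite (carrier G)" "extremal_seqs_bounded G"
  shows "davenport_quotient_gap G"
  unfolding davenport_quotient_gap_def
proof (intro allI impI, elim conjE)
  fix H assume H: "subgroup H G" and "G\<lparr>carrier := H\<rparr> \<cong> integer_mod_group 2"
  then have "card H = 2" using iso_integer_mod_group_two_iff by blast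
  then obtain h where h: "h \<in> carrier G" "h \<noteq> \<one>" "H = {\<one>, h}" "h \<otimes> h = \<one>" "inv h = h" "ord h = 2"
    using subgroup_order_two[OF H] by metis
  interpret Q: comm_group "G Mod H" using H by (rule abelian_FactGroup)
  note finQ = finite_carrier_quotient[OF H assms(1)]
  show "davenport (G Mod H) + 2 \<le> davenport G"
  proof (rule ccontr)
    assume "\<not> ?thesis"
    \<comment> \<open>This much holds for every \<open>H\<close> of order 2, so failure of the gap
      forces equality.\<close>
    moreover have "davenport (G Mod H) + 1 \<le> davenport G"
      using davenport_quotient[OF H assms(1), of h] h by simp
    ultimately have D: "davenport G = davenport (G Mod H) + 1" by simp
    obtain S' where S': "seq_over (G Mod H) S'" "zero_sum_free (G Mod H) S'"
      "Suc (size S') = davenport (G Mod H)"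
      using Q.exists_zero_sum_free finQ by blast
    obtain S where S: "seq_over G S" "image_mset (\<lambda>x. H #> x) S = S'"
      using seq_lift[OF H S'(1)] by blast
    have "size S = size S'" using S(2) by (metis size_image_mset)
    then have size: "Suc (size S) = davenport (G Mod H)" using S'(3) by simp
    have "num_subsums (G Mod H) \<one>\<^bsub>G Mod H\<^esub> S' = 1"
      using S' by (intro Q.num_subsums_zero_sum_free)
    \<comment> \<open>The single index set for 0 over G/H lifts to a single index set with sum in
      {0, h}.\<close>
    then have base: "num_subsums G \<one> S + num_subsums G h S = 1"
      using num_subsums_quotient_one[OF H assms(1) S(1)] S(2) h(2,3) by simp
    \<comment> \<open>Since h = -h, appending \<open>h\<close> replaces both N_0 and N_h by their
      sum. The first copy makes them both 1, and each further copy doubles them.\<close>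
    have count: "num_subsums G \<one> (S + replicate_mset (Suc k) h) = 2 ^ k \<and>
        num_subsums G h (S + replicate_mset (Suc k) h) = 2 ^ k" for k
    proof (induction k)
      case 0
      show ?case using num_subsums_add[OF h(1) S(1)] base h by simp
    next
      case (Suc k)
      have "seq_over G (S + replicate_mset (Suc k) h)" using S(1) h(1) by (simp add: seq_over_replicate)
      then show ?case
        using num_subsums_add[OF h(1), of "S + replicate_mset (Suc k) h"] Suc h by simp
    qed
    have one: "\<one> \<notin># S"
    proof
      assume "\<one> \<in># S"
      then have "{#\<one>#} \<subseteq># S" by simp
      then have "image_mset (\<lambda>x. H #> x) {#\<one>#} \<subseteq># S'" using S(2) image_mset_subseteq_mono by blast
      moreover have "H #> \<one> = H" using coset_eq_subgroup_iff[OF H one_closed] h(3) by blast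
      ultimately have "{#H#} \<subseteq># S'" by simp
      moreover have "seq_sum (G Mod H) {#H#} = H"
        using Q.seq_sum_add[OF Q.one_closed seq_over_empty] Q.one_closed Q.r_one by (metis Q.seq_sum_empty one_FactGroup)
      ultimately show False using S'(2) unfolding zero_sum_free_def by (metis multi_self_add_other_not_self one_FactGroup add_mset_not_empty)
    qed
    obtain t where t: "\<And>S. seq_over G S \<Longrightarrow> \<one> \<notin># S \<Longrightarrow> attains_bound G \<one> S \<Longrightarrow> size S \<le> t"
      using assms(2) unfolding extremal_seqs_bounded_def by blast
    \<comment> \<open>The exponent |T| - D(G) + 1 equals t, because |S| = D(G) - 2 and t + 1 copies
      of \<open>h\<close> are appended.\<close>
    let ?T = "S + replicate_mset (Suc t) h"
    have "num_subsums G \<one> ?T * 2 ^ (davenport G - 1) = 2 ^ (t + davenport (G Mod H))"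
      using count[of t] D by (simp add: power_add)
    also have "t + davenport (G Mod H) = size ?T" using size by simp
    finally have "attains_bound G \<one> ?T" using attains_bound_iff[OF assms(1)] by blast
    moreover have "seq_over G ?T" "\<one> \<notin># ?T" using S(1) h one by (auto simp: seq_over_replicate)
    ultimately have "size ?T \<le> t" using t by blast
    then show False by simp
  qed
qed

text \<open>A cyclic subgroup \<open>H\<close> of order \<open>n\<close> inside \<open>E(S)\<close> gives, by summing \<open>N\<^sub>h(S)\<close> over \<open>H\<close> and applying
  Olson's bound in \<open>G/H\<close>, that \<open>2\<^bsup>n-1\<^esup> \<le> 2\<^bsup>D(G)-D(G/H)\<^esup> \<le> n\<close>; hence \<open>n = 2\<close>.\<close>

lemma quotient_gap_imp_no_subgroup:
  assumes "finite (carrier G)" "davenport_quotient_gap G"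
  shows "extremal_sets_no_subgroup G"
  unfolding extremal_sets_no_subgroup_def
proof (intro allI impI notI, elim conjE exE)
  fix S K assume S: "seq_over G S" and K: "subgroup K G" "K \<noteq> {\<one>}" "K \<subseteq> extremal_set G S"
  obtain h where hK: "h \<in> K" "h \<noteq> \<one>" using K subgroup.one_closed[OF K(1)] by blast
  then have h: "h \<in> carrier G" using K(1) by (meson subgroup.mem_carrier)
  define H where "H = generate G {h}"
  have H: "subgroup H G" unfolding H_def using h by (intro generate_is_subgroup) simp
  have hH: "h \<in> H" unfolding H_def by (rule generate.incl) simp
  have HK: "H \<subseteq> K" unfolding H_def using hK K(1) by (intro generate_subgroup_incl) auto
  have n: "ord h = card H" unfolding H_def using h by (rule generate_pow_card)
  have "ord h \<noteq> 1" "ord h \<ge> 1" using hK(2) h ord_eq_1 ord_ge_1[OF assms(1)] by auto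
  then have n2: "2 \<le> card H" using n by simp
  interpret Q: comm_group "G Mod H" using H by (rule abelian_FactGroup)
  note finQ = finite_carrier_quotient[OF H assms(1)]
  define D where "D = davenport G - 1"
  define D' where "D' = davenport (G Mod H) - 1"
  have D: "davenport G = Suc D" using davenport_pos[OF assms(1)] by (simp add: D_def)
  have D': "davenport (G Mod H) = Suc D'" using Q.davenport_pos[OF finQ] by (simp add: D'_def)
  let ?S' = "image_mset (\<lambda>x. H #> x) S"
  let ?N = "num_subsums (G Mod H) H ?S'"
  have "?N * 2 ^ D = (\<Sum>x\<in>H. num_subsums G x S * 2 ^ D)"
    using num_subsums_quotient_one[OF H assms(1) S] by (simp add: sum_distrib_right)
  also have "\<dots> = (\<Sum>x\<in>H. 2 ^ size S)"
    using HK K(3) attains_bound_iff[OF assms(1)] unfolding extremal_set_def D_def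
    by (intro sum.cong) auto
  finally have N: "?N * 2 ^ D = card H * 2 ^ size S" by simp
  then have "0 < ?N" using n2 by (intro Nat.gr0I) auto
  then have "2 ^ size ?S' \<le> ?N * 2 ^ D'"
    using Q.num_subsums_lower_bound[OF finQ seq_over_proj[OF H S], of H] Q.one_closed unfolding D'_def by simp
  then have "2 ^ size S * 2 ^ D \<le> ?N * 2 ^ D' * 2 ^ D" by simp
  also have "\<dots> = 2 ^ size S * (card H * 2 ^ D')" using N by (simp add: mult.commute mult.left_commute)
  finally have le: "2 ^ D \<le> card H * 2 ^ D'" by simp
  \<comment> \<open>As \<open>H\<close> is generated by \<open>h\<close>, its cardinality is the
    order of \<open>h\<close>, and the general quotient inequality applies.\<close>
  have gap: "D' + (card H - 1) \<le> D" using davenport_quotient[OF H assms(1) hH] n D D' n2 by linarith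
  have "(2::nat) ^ (D' + (card H - 1)) \<le> 2 ^ D" using gap by (intro power_increasing) auto
  then have "2 ^ D' * 2 ^ (card H - 1) \<le> 2 ^ D' * card H"
    using le unfolding power_add mult.commute[of "card H"] by (rule order_trans)
  then have small: "2 ^ (card H - 1) \<le> card H" by simp
  have large: "m + 3 < 2 ^ (m + 2)" for m :: nat by (induction m) auto
  have "\<not> 3 \<le> card H"
  proof
    assume "3 \<le> card H"
    then have "card H - 3 + 3 = card H" "card H - 3 + 2 = card H - 1" by auto
    then show False using large[of "card H - 3"] small by simp
  qed
  then have c2: "card H = 2" using n2 by simp
  \<comment> \<open>For |H| = 2 the estimate reads D(G) <= D(G/H) + 1, which the assumed gap
    forbids.\<close>
  then have "(2::nat) ^ D \<le> 2 ^ Suc D'" using le by simp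
  then have "D \<le> Suc D'" by (simp only: power_increasing_iff)
  moreover have "davenport (G Mod H) + 2 \<le> davenport G"
    using assms(2) H c2 iso_integer_mod_group_two_iff unfolding davenport_quotient_gap_def by blast
  ultimately show False using D D' by simp
qed

text \<open>Deleting one \<open>x\<close> splits each extremal count into N at -ix and N at -(i+1)x
  for the shorter sequence, and the two add up to twice its lower bound. For i = 0 both are
  positive, hence both equal the bound; from there each equation determines the next value, one step
  beyond j.\<close>

lemma attains_bound_remove:
  assumes fin: "finite (carrier G)" and x: "x \<in> carrier G" and S: "seq_over G S"
    and ord: "order G \<le> Suc (count S x)"
    and att: "\<And>i. i \<le> j \<Longrightarrow> attains_bound G (inv x [^] i) (add_mset x S)"
  shows "i \<le> Suc j \<Longrightarrow> attains_bound G (inv x [^] i) S"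
proof -
  let ?N = "\<lambda>i. num_subsums G (inv x [^] (i::nat)) S * 2 ^ (davenport G - 1)"
  have eq: "?N i + ?N (Suc i) = 2 * 2 ^ size S" if "i \<le> j" for i
    using att[OF that] x num_subsums_add[OF x S, of "inv x [^] i"]
    unfolding attains_bound_iff[OF fin] by (simp add: add_mult_distrib)
  \<comment> \<open>Positivity of N at -x: |G| copies of \<open>x\<close> sum to 0, and dropping one
    of them leaves a subsequence of \<open>S\<close>.\<close>
  obtain T where T: "T \<subseteq># add_mset x S" "x \<in># T" "seq_sum G T = \<one>"
    using replicate_zero_sum_exists[OF fin, of "add_mset x S" x] x S ord by auto
  obtain U where U: "T = add_mset x U" using T(2) by (metis mset_add)
  have US: "U \<subseteq># S" using T(1) U by simp
  then have "seq_over G U" using S seq_over_subset by blast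
  then have "seq_sum G U = inv x" using T(3) U x by (metis comm_inv_char seq_sum_add seq_sum_closed)
  then have p1: "0 < num_subsums G (inv x) S" using num_subsums_pos_iff S x US by blast
  have p0: "0 < num_subsums G \<one> S"
    using num_subsums_pos_iff[OF S one_closed] by (metis empty_le seq_sum_empty)
  have "2 ^ size S \<le> ?N 0" using num_subsums_lower_bound[OF fin S one_closed p0] by simp
  moreover have "2 ^ size S \<le> ?N 1" using num_subsums_lower_bound[OF fin S _ p1] x by simp
  moreover have "?N 0 + ?N 1 = 2 * 2 ^ size S" using eq[of 0] by simp
  ultimately have base: "?N 0 = 2 ^ size S" by linarith
  have "?N i = 2 ^ size S" if "i \<le> Suc j" for i
    using that
  proof (induction i)
    case 0
    show ?case by (rule base)
  next
    case (Suc i)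
    then show ?case using eq[of i] by simp
  qed
  then show "i \<le> Suc j \<Longrightarrow> attains_bound G (inv x [^] i) S" using attains_bound_iff[OF fin] by blast
qed

text \<open>Every removal lengthens the run of extremal multiples of -x by one. The assumption on
  \<open>count S x\<close> leaves |G| copies of \<open>x\<close> even after the last removal, so
  each single step is permitted.\<close>

lemma attains_bound_remove_many:
  assumes "finite (carrier G)" "x \<in> carrier G" "seq_over G S"
    and "attains_bound G \<one> S" "order G + j \<le> count S x" "i \<le> j"
  shows "attains_bound G (inv x [^] i) (S - replicate_mset j x)"
  using assms(5,6)
proof (induction j arbitrary: i)
  case 0
  then show ?case using assms by simp
next
  case (Suc j)
  define U where "U = S - replicate_mset (Suc j) x"
  have U: "S - replicate_mset j x = add_mset x U"
    unfolding U_def using Suc.prems(1) by (intro multiset_eqI) auto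
  have "attains_bound G (inv x [^] i) (add_mset x U)" if "i \<le> j" for i
    using Suc.IH[of i] Suc.prems that unfolding U by simp
  moreover have "seq_over G U" unfolding U_def using assms(3) by (rule seq_over_subset) simp
  moreover have "order G \<le> Suc (count U x)" unfolding U_def using Suc.prems(1) by simp
  ultimately have "attains_bound G (inv x [^] i) U"
    using attains_bound_remove[OF assms(1,2), of U j i] Suc.prems(2) by blast
  then show ?case unfolding U_def .
qed

lemma no_subgroup_imp_bounded:
  assumes "finite (carrier G)" "extremal_sets_no_subgroup G"
  shows "extremal_seqs_bounded G"
  unfolding extremal_seqs_bounded_def
proof (intro exI allI impI, elim conjE)
  fix S assume S: "seq_over G S" "\<one> \<notin># S" "attains_bound G \<one> S"
  \<comment> \<open>The product forces a term with more than 2|G| copies: |G| to be removed, and |G|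
    to remain. The summand D(G) keeps the shortened sequence long enough for (iv).\<close>
  show "size S \<le> order G * (2 * order G) + davenport G"
  proof (rule ccontr)
    assume long: "\<not> ?thesis"
    then obtain x where xS: "x \<in># S" and cnt: "2 * order G < count S x"
      using exists_large_multiplicity[OF assms(1), of S "2 * order G"] S(1)
      by (auto simp: seq_over_def order_def)
    have x: "x \<in> carrier G" "x \<noteq> \<one>" using xS S by (auto simp: seq_over_def)
    have o: "0 < order G" using assms(1) order_gt_0_iff_finite by blast
    define V where "V = S - replicate_mset (order G) x"
    have V: "seq_over G V" unfolding V_def using S(1) by (rule seq_over_subset) simp
    have "order G \<le> count S x" using cnt by simp
    then have "replicate_mset (order G) x \<subseteq># S" by (simp add: count_le_replicate_mset_subset_eq)
    then have "size V = size S - order G" unfolding V_def by (simp add: size_Diff_submset)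
    moreover have "order G * 1 \<le> order G * (2 * order G)" using o by (intro mult_le_mono) auto
    ultimately have size: "davenport G - 1 \<le> size V" using long by linarith
    define H where "H = generate G {inv x}"
    have H: "subgroup H G" unfolding H_def using x by (intro generate_is_subgroup) simp
    have "inv x \<in> H" unfolding H_def by (rule generate.incl) simp
    then have "H \<noteq> {\<one>}" using x by auto
    moreover have "H \<subseteq> extremal_set G V"
    proof
      fix y assume y: "y \<in> H"
      then obtain k :: nat where k: "y = inv x [^] k"
        unfolding H_def using generate_pow_on_finite_carrier[OF assms(1), of "inv x"] x by auto
      \<comment> \<open>Reducing the exponent modulo |G| brings it into the range 0, ..., |G|
        covered by the removals.\<close>
      have "y = inv x [^] (k mod order G)"
      proof -
        have "inv x [^] k = inv x [^] (order G * (k div order G) + k mod order G)" by simp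
        also have "\<dots> = inv x [^] (order G * (k div order G)) \<otimes> inv x [^] (k mod order G)"
          using x by (simp add: nat_pow_mult)
        also have "inv x [^] (order G * (k div order G)) = \<one>"
          using x by (simp add: nat_pow_pow[symmetric] pow_order_eq_1)
        finally show ?thesis using k x by simp
      qed
      moreover have "attains_bound G (inv x [^] (k mod order G)) V"
        unfolding V_def using attains_bound_remove_many[OF assms(1) x(1) S(1,3)] cnt o
        by (simp add: less_imp_le)
      ultimately show "y \<in> extremal_set G V" using x by (simp add: extremal_set_def)
    qed
    ultimately show False using assms(2) V size H unfolding extremal_sets_no_subgroup_def by blast
  qed
qed

end

theorem theorem3p7:
  fixes G :: "('a, 'b) monoid_scheme" and r :: nat and n :: "nat \<Rightarrow> nat"
  assumes "comm_group G" and "finite (carrier G)"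
    and "\<forall>i\<in>{1..r}. 0 < n i"
    and "\<forall>i\<in>{1..<r}. n i dvd n (i + 1)"
    and "G \<cong> product_group {1..r} (\<lambda>i. integer_mod_group (n i))"
  shows "(extremal_seqs_disjoint G \<longrightarrow> extremal_seqs_bounded G) \<and>
    (extremal_seqs_bounded G \<longleftrightarrow> davenport_quotient_gap G) \<and>
    (davenport_quotient_gap G \<longleftrightarrow> extremal_sets_no_subgroup G)"
proof -
  interpret comm_group G by fact
  show ?thesis
    using disjoint_imp_bounded bounded_imp_quotient_gap[OF assms(2)]
      quotient_gap_imp_no_subgroup[OF assms(2)] no_subgroup_imp_bounded[OF assms(2)]
    by blast
qed

end
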